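(* Let $(W,+,0)$ be a monoid. The writer monad $X\mapsto X\times W$ on the category of sets is transposable: the Kleisli category of the writer monad is equivalent, by an identity-on-objects equivalence, to the category of contextful arrows (loose arrows of $\mathrm{Ctx}$) of the dependently graded writer comonad.
   Context: **Writer monad.** Unit $x\mapsto(x,0)$, multiplication $((x,w_1),w_2)\mapsto(x,w_1+w_2)$. **Dependently and discretely graded comonads.** Such a structure on a category $\mathcal{C}$ consists of: a presheaf of sets (of grades) $\mathcal{M}_{(-)}:\mathcal{C}^{\mathrm{op}}\to\mathrm{Set}$, with reindexing $f^*$; for each $C$ and $M\in\mathcal{M}_C$ an object $C\odot M$, and for each $f:C\to C'$ and $M'\in\mathcal{M}_{C'}$ a morphism $f\odot M':C\odot f^*M'\to C'\odot M'$, functorially; a grade $I_C\in\mathcal{M}_C$ with $f^*I_{C'}=I_C$; for $M\in\mathcal{M}_C$ and $N\in\mathcal{M}_{C\odot M}$ a grade $M\otimes N\in\mathcal{M}_C$ with $f^*(M'\otimes N')=f^*M'\otimes(f\odot M')^*N'$; natural maps $\varepsilon_C:C\odot I_C\to C$ and $\delta_{M,N}:C\odot(M\otimes N)\to(C\odot M)\odot N$; such that $I_C\otimes\varepsilon^*M=M$, $M\otimes I_{C\odot M}=M$, $M\otimes(N\otimes L)=(M\otimes N)\otimes\delta^*L$, and $(\varepsilon\odot M)\circ\delta_{I,\varepsilon^*M}=\mathrm{id}$, $\varepsilon\circ\delta_{M,I}=\mathrm{id}$, $\delta_{N,L}\circ\delta_{M,N\otimes L}=(\delta_{M,N}\odot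 L)\circ\delta_{M\otimes N,\delta^*L}$. **Category of contextful arrows** (loose arrows of $\mathrm{Ctx}(\odot)$). Objects are those of $\mathcal{C}$; morphisms $A\to B$ are pairs $(P,f)$ with $P\in\mathcal{M}_A$ and $f:A\odot P\to B$; identities are $(I_A,\varepsilon_A)$; the composite of $(P,f):A\to B$ followed by $(Q,g):B\to C$ is $(P\otimes f^*Q,\ g\circ(f\odot Q)\circ\delta_{P,f^*Q})$. A monad $T$ on $\mathcal{C}$ is **transposable** if there is a dependently and discretely graded comonad $\odot_T$ on $\mathcal{C}$ together with an identity-on-objects equivalence between the Kleisli category of $T$ and the category of loose arrows of $\mathrm{Ctx}(\odot_T)$. **Dependently graded writer comonad** on sets: the grades over $X$ are functions $w:X\to W$, contravariant in $X$ by precomposition; $X\odot w:=X$ (and $h\odot w:=h$); $I_X$ is the constant function at $0$; $(w_1\otimes w_2)(x):=w_1(x)+w_2(x)$; $\varepsilon_X$ and $\delta_{w_1,w_2}$ are identities.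
   Formalization: The explicit equivalence fails for some noncommutative W: Kleisli composition gives v+u, contextful composition u+v. The formal theorem proves transposability for all W, the equivalence with W replaced by its opposite on either side, and the literal one when W is isomorphic to its opposite. *)

theory Defs
  imports "HOL-Algebra.Group"
begin

section \<open>Categories, functors, equivalences\<close>

text \<open>
  Hom-sets are not assumed to be disjoint, so composition is indexed by objects:
  \<open>Comp C X Y Z g f\<close> is the composite of \<open>f : X \<rightarrow> Y\<close> followed by \<open>g : Y \<rightarrow> Z\<close>.
  The same convention (source and target as explicit arguments) is used for every
  operation on arrows below.
\<close>

record ('o, 'm) cat =
  Ob :: "'o set"
  Hom :: "'o \<Rightarrow> 'o \<Rightarrow> 'm set"
  Idt :: "'o \<Rightarrow> 'm"
  Comp :: "'o \<Rightarrow> 'o \<Rightarrow> 'o \<Rightarrow> 'm \<Rightarrow> 'm \<Rightarrow> 'm"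

locale category =
  fixes C :: "('o, 'm) cat"
  assumes Idt_closed: "X \<in> Ob C \<Longrightarrow> Idt C X \<in> Hom C X X"
    and Comp_closed: "\<lbrakk>X \<in> Ob C; Y \<in> Ob C; Z \<in> Ob C; f \<in> Hom C X Y; g \<in> Hom C Y Z\<rbrakk>
      \<Longrightarrow> Comp C X Y Z g f \<in> Hom C X Z"
    and Idt_left: "\<lbrakk>X \<in> Ob C; Y \<in> Ob C; f \<in> Hom C X Y\<rbrakk> \<Longrightarrow> Comp C X Y Y (Idt C Y) f = f"
    and Idt_right: "\<lbrakk>X \<in> Ob C; Y \<in> Ob C; f \<in> Hom C X Y\<rbrakk> \<Longrightarrow> Comp C X X Y f (Idt C X) = f"
    and Comp_assoc: "\<lbrakk>X \<in> Ob C; Y \<in> Ob C; Z \<in> Ob C; V \<in> Ob C;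
        f \<in> Hom C X Y; g \<in> Hom C Y Z; h \<in> Hom C Z V\<rbrakk>
      \<Longrightarrow> Comp C X Y V (Comp C Y Z V h g) f = Comp C X Z V h (Comp C X Y Z g f)"

record ('o, 'm, 'p, 'n) funct =
  FOb :: "'o \<Rightarrow> 'p"
  FMap :: "'o \<Rightarrow> 'o \<Rightarrow> 'm \<Rightarrow> 'n"

locale is_functor = C: category C + D: category D
  for C :: "('o, 'm) cat" and D :: "('p, 'n) cat" +
  fixes F :: "('o, 'm, 'p, 'n) funct"
  assumes FOb_closed: "X \<in> Ob C \<Longrightarrow> FOb F X \<in> Ob D"
    and FMap_closed: "\<lbrakk>X \<in> Ob C; Y \<in> Ob C; f \<in> Hom C X Y\<rbrakk>
      \<Longrightarrow> FMap F X Y f \<in> Hom D (FOb F X) (FOb F Y)"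
    and FMap_Idt: "X \<in> Ob C \<Longrightarrow> FMap F X X (Idt C X) = Idt D (FOb F X)"
    and FMap_Comp: "\<lbrakk>X \<in> Ob C; Y \<in> Ob C; Z \<in> Ob C; f \<in> Hom C X Y; g \<in> Hom C Y Z\<rbrakk>
      \<Longrightarrow> FMap F X Z (Comp C X Y Z g f)
        = Comp D (FOb F X) (FOb F Y) (FOb F Z) (FMap F Y Z g) (FMap F X Y f)"

definition id_funct :: "('o, 'm, 'o, 'm) funct" where
  "id_funct = \<lparr>FOb = (\<lambda>X. X), FMap = (\<lambda>X Y f. f)\<rparr>"

definition comp_funct ::
    "('p, 'n, 'q, 'k) funct \<Rightarrow> ('o, 'm, 'p, 'n) funct \<Rightarrow> ('o, 'm, 'q, 'k) funct" where
  "comp_funct G F = \<lparr>FOb = (\<lambda>X. FOb G (FOb F X)),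
     FMap = (\<lambda>X Y f. FMap G (FOb F X) (FOb F Y) (FMap F X Y f))\<rparr>"

locale nat_trans = F: is_functor C D F + G: is_functor C D G
  for C :: "('o, 'm) cat" and D :: "('p, 'n) cat"
    and F :: "('o, 'm, 'p, 'n) funct" and G :: "('o, 'm, 'p, 'n) funct" +
  fixes \<tau> :: "'o \<Rightarrow> 'n"
  assumes component_closed: "X \<in> Ob C \<Longrightarrow> \<tau> X \<in> Hom D (FOb F X) (FOb G X)"
    and naturality: "\<lbrakk>X \<in> Ob C; Y \<in> Ob C; f \<in> Hom C X Y\<rbrakk>
      \<Longrightarrow> Comp D (FOb F X) (FOb F Y) (FOb G Y) (\<tau> Y) (FMap F X Y f)
        = Comp D (FOb F X) (FOb G X) (FOb G Y) (FMap G X Y f) (\<tau> X)"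

definition iso_arrow :: "('o, 'm) cat \<Rightarrow> 'o \<Rightarrow> 'o \<Rightarrow> 'm \<Rightarrow> bool" where
  "iso_arrow C X Y f \<longleftrightarrow> f \<in> Hom C X Y \<and>
     (\<exists>g \<in> Hom C Y X. Comp C X Y X g f = Idt C X \<and> Comp C Y X Y f g = Idt C Y)"

definition naturally_isomorphic ::
    "('o, 'm) cat \<Rightarrow> ('p, 'n) cat \<Rightarrow> ('o, 'm, 'p, 'n) funct \<Rightarrow> ('o, 'm, 'p, 'n) funct \<Rightarrow> bool" where
  "naturally_isomorphic C D F G \<longleftrightarrow>
     (\<exists>\<tau>. nat_trans C D F G \<tau> \<and> (\<forall>X \<in> Ob C. iso_arrow D (FOb F X) (FOb G X) (\<tau> X)))"

definition equivalence :: "('o, 'm) cat \<Rightarrow> ('p, 'n) cat \<Rightarrow> ('o, 'm, 'p, 'n) funct \<Rightarrow> bool" where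
  "equivalence C D F \<longleftrightarrow> is_functor C D F \<and>
     (\<exists>G. is_functor D C G \<and>
        naturally_isomorphic C C (comp_funct G F) id_funct \<and>
        naturally_isomorphic D D (comp_funct F G) id_funct)"

definition id_on_obj_equivalent :: "('o, 'm) cat \<Rightarrow> ('o, 'n) cat \<Rightarrow> bool" where
  "id_on_obj_equivalent C D \<longleftrightarrow> Ob C = Ob D \<and>
     (\<exists>F. equivalence C D F \<and> (\<forall>X \<in> Ob C. FOb F X = X))"


section \<open>Monads and Kleisli categories\<close>

record ('o, 'm) monad_data =
  Fun :: "('o, 'm, 'o, 'm) funct"
  Unit :: "'o \<Rightarrow> 'm"
  Mul :: "'o \<Rightarrow> 'm"

locale is_monad =
  fixes C :: "('o, 'm) cat" and T :: "('o, 'm) monad_data"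
  assumes Unit_natural: "nat_trans C C id_funct (Fun T) (Unit T)"
    and Mul_natural: "nat_trans C C (comp_funct (Fun T) (Fun T)) (Fun T) (Mul T)"
    and Mul_Unit_outer: "X \<in> Ob C \<Longrightarrow>
      (let TX = FOb (Fun T) X; TTX = FOb (Fun T) TX in
        Comp C TX TTX TX (Mul T X) (Unit T TX) = Idt C TX)"
    and Mul_Unit_inner: "X \<in> Ob C \<Longrightarrow>
      (let TX = FOb (Fun T) X; TTX = FOb (Fun T) TX in
        Comp C TX TTX TX (Mul T X) (FMap (Fun T) X TX (Unit T X)) = Idt C TX)"
    and Mul_assoc: "X \<in> Ob C \<Longrightarrow>
      (let TX = FOb (Fun T) X; TTX = FOb (Fun T) TX; TTTX = FOb (Fun T) TTX in
        Comp C TTTX TTX TX (Mul T X) (FMap (Fun T) TTX TX (Mul T X))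
          = Comp C TTTX TTX TX (Mul T X) (Mul T TX))"

definition Kleisli :: "('o, 'm) cat \<Rightarrow> ('o, 'm) monad_data \<Rightarrow> ('o, 'm) cat" where
  "Kleisli C T = (let T0 = FOb (Fun T) in
    \<lparr>Ob = Ob C,
     Hom = (\<lambda>X Y. Hom C X (T0 Y)),
     Idt = Unit T,
     Comp = (\<lambda>X Y Z g f.
       Comp C X (T0 (T0 Z)) (T0 Z) (Mul T Z)
         (Comp C X (T0 Y) (T0 (T0 Z)) (FMap (Fun T) Y (T0 Z) g) f))\<rparr>)"


section \<open>Dependently and discretely graded comonads\<close>

text \<open>
  For \<open>f : X \<rightarrow> Y\<close>: \<open>Gr G X\<close> is the set of grades over \<open>X\<close>, \<open>Reix G X Y f N\<close> is
  \<open>f\<^sup>* N\<close>, \<open>Act G X M\<close> is \<open>X \<odot> M\<close>, and \<open>ActMap G X Y f N\<close> is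
  \<open>f \<odot> N : X \<odot> f\<^sup>* N \<rightarrow> Y \<odot> N\<close>.  \<open>IGr\<close> and \<open>Ten\<close> are the unit grade and the
  tensor of grades, \<open>Eps\<close> and \<open>Del\<close> the counit and the comultiplication.
\<close>

record ('o, 'm, 'g) graded_data =
  Gr :: "'o \<Rightarrow> 'g set"
  Reix :: "'o \<Rightarrow> 'o \<Rightarrow> 'm \<Rightarrow> 'g \<Rightarrow> 'g"
  Act :: "'o \<Rightarrow> 'g \<Rightarrow> 'o"
  ActMap :: "'o \<Rightarrow> 'o \<Rightarrow> 'm \<Rightarrow> 'g \<Rightarrow> 'm"
  IGr :: "'o \<Rightarrow> 'g"
  Ten :: "'o \<Rightarrow> 'g \<Rightarrow> 'g \<Rightarrow> 'g"
  Eps :: "'o \<Rightarrow> 'm"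
  Del :: "'o \<Rightarrow> 'g \<Rightarrow> 'g \<Rightarrow> 'm"

locale dg_comonad = category C
  for C :: "('o, 'm) cat" +
  fixes G :: "('o, 'm, 'g) graded_data"
  assumes Reix_closed: "\<lbrakk>X \<in> Ob C; Y \<in> Ob C; f \<in> Hom C X Y; N \<in> Gr G Y\<rbrakk>
      \<Longrightarrow> Reix G X Y f N \<in> Gr G X"
    and Reix_Idt: "\<lbrakk>X \<in> Ob C; M \<in> Gr G X\<rbrakk> \<Longrightarrow> Reix G X X (Idt C X) M = M"
    and Reix_Comp: "\<lbrakk>X \<in> Ob C; Y \<in> Ob C; Z \<in> Ob C; f \<in> Hom C X Y; g \<in> Hom C Y Z; L \<in> Gr G Z\<rbrakk>
      \<Longrightarrow> Reix G X Z (Comp C X Y Z g f) L = Reix G X Y f (Reix G Y Z g L)"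
    and Act_closed: "\<lbrakk>X \<in> Ob C; M \<in> Gr G X\<rbrakk> \<Longrightarrow> Act G X M \<in> Ob C"
    and ActMap_closed: "\<lbrakk>X \<in> Ob C; Y \<in> Ob C; f \<in> Hom C X Y; N \<in> Gr G Y\<rbrakk>
      \<Longrightarrow> ActMap G X Y f N \<in> Hom C (Act G X (Reix G X Y f N)) (Act G Y N)"
    and ActMap_Idt: "\<lbrakk>X \<in> Ob C; M \<in> Gr G X\<rbrakk>
      \<Longrightarrow> ActMap G X X (Idt C X) M = Idt C (Act G X M)"
    and ActMap_Comp: "\<lbrakk>X \<in> Ob C; Y \<in> Ob C; Z \<in> Ob C; f \<in> Hom C X Y; g \<in> Hom C Y Z; L \<in> Gr G Z\<rbrakk>
      \<Longrightarrow> ActMap G X Z (Comp C X Y Z g f) L =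
        (let gL = Reix G Y Z g L in
          Comp C (Act G X (Reix G X Y f gL)) (Act G Y gL) (Act G Z L)
            (ActMap G Y Z g L) (ActMap G X Y f gL))"
    and IGr_closed: "X \<in> Ob C \<Longrightarrow> IGr G X \<in> Gr G X"
    and Reix_IGr: "\<lbrakk>X \<in> Ob C; Y \<in> Ob C; f \<in> Hom C X Y\<rbrakk> \<Longrightarrow> Reix G X Y f (IGr G Y) = IGr G X"
    and Ten_closed: "\<lbrakk>X \<in> Ob C; M \<in> Gr G X; N \<in> Gr G (Act G X M)\<rbrakk> \<Longrightarrow> Ten G X M N \<in> Gr G X"
    and Reix_Ten: "\<lbrakk>X \<in> Ob C; Y \<in> Ob C; f \<in> Hom C X Y; M \<in> Gr G Y; N \<in> Gr G (Act G Y M)\<rbrakk>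
      \<Longrightarrow> Reix G X Y f (Ten G Y M N) =
        (let fM = Reix G X Y f M in
          Ten G X fM (Reix G (Act G X fM) (Act G Y M) (ActMap G X Y f M) N))"
    and Eps_closed: "X \<in> Ob C \<Longrightarrow> Eps G X \<in> Hom C (Act G X (IGr G X)) X"
    and Eps_natural: "\<lbrakk>X \<in> Ob C; Y \<in> Ob C; f \<in> Hom C X Y\<rbrakk>
      \<Longrightarrow> Comp C (Act G X (IGr G X)) (Act G Y (IGr G Y)) Y (Eps G Y) (ActMap G X Y f (IGr G Y))
        = Comp C (Act G X (IGr G X)) X Y f (Eps G X)"
    and Del_closed: "\<lbrakk>X \<in> Ob C; M \<in> Gr G X; N \<in> Gr G (Act G X M)\<rbrakk>
      \<Longrightarrow> Del G X M N \<in> Hom C (Act G X (Ten G X M N)) (Act G (Act G X M) N)"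
    and Del_natural: "\<lbrakk>X \<in> Ob C; Y \<in> Ob C; f \<in> Hom C X Y; M \<in> Gr G Y; N \<in> Gr G (Act G Y M)\<rbrakk>
      \<Longrightarrow>
        (let fM = Reix G X Y f M;
             XM = Act G X fM; YM = Act G Y M;
             fMN = Reix G XM YM (ActMap G X Y f M) N;
             XMN = Act G XM fMN; YMN = Act G YM N;
             MN = Ten G Y M N;
             X' = Act G X (Reix G X Y f MN); Y' = Act G Y MN
         in Comp C X' Y' YMN (Del G Y M N) (ActMap G X Y f MN)
          = Comp C X' XMN YMN (ActMap G XM YM (ActMap G X Y f M) N) (Del G X fM fMN))"
    and Ten_IGr_left: "\<lbrakk>X \<in> Ob C; M \<in> Gr G X\<rbrakk>
      \<Longrightarrow> Ten G X (IGr G X) (Reix G (Act G X (IGr G X)) X (Eps G X) M) = M"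
    and Ten_IGr_right: "\<lbrakk>X \<in> Ob C; M \<in> Gr G X\<rbrakk> \<Longrightarrow> Ten G X M (IGr G (Act G X M)) = M"
    and Ten_assoc: "\<lbrakk>X \<in> Ob C; M \<in> Gr G X; N \<in> Gr G (Act G X M); L \<in> Gr G (Act G (Act G X M) N)\<rbrakk>
      \<Longrightarrow> Ten G X M (Ten G (Act G X M) N L) =
        (let MN = Ten G X M N in
          Ten G X MN (Reix G (Act G X MN) (Act G (Act G X M) N) (Del G X M N) L))"
    and Del_Eps_left: "\<lbrakk>X \<in> Ob C; M \<in> Gr G X\<rbrakk> \<Longrightarrow>
        (let XI = Act G X (IGr G X);
             eM = Reix G XI X (Eps G X) M;
             XM = Act G X M
         in Comp C XM (Act G XI eM) XM (ActMap G XI X (Eps G X) M) (Del G X (IGr G X) eM)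
          = Idt C XM)"
    and Del_Eps_right: "\<lbrakk>X \<in> Ob C; M \<in> Gr G X\<rbrakk> \<Longrightarrow>
        (let XM = Act G X M in
          Comp C XM (Act G XM (IGr G XM)) XM (Eps G XM) (Del G X M (IGr G XM)) = Idt C XM)"
    and Del_coassoc: "\<lbrakk>X \<in> Ob C; M \<in> Gr G X; N \<in> Gr G (Act G X M); L \<in> Gr G (Act G (Act G X M) N)\<rbrakk>
      \<Longrightarrow>
        (let XM = Act G X M; XMN = Act G XM N; XMNL = Act G XMN L;
             MN = Ten G X M N; NL = Ten G XM N L;
             dL = Reix G (Act G X MN) XMN (Del G X M N) L;
             X' = Act G X (Ten G X M NL)
         in Comp C X' (Act G XM NL) XMNL (Del G XM N L) (Del G X M NL)
          = Comp C X' (Act G (Act G X MN) dL) XMNL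
              (ActMap G (Act G X MN) XMN (Del G X M N) L) (Del G X MN dL))"

definition Ctx_loose ::
    "('o, 'm) cat \<Rightarrow> ('o, 'm, 'g) graded_data \<Rightarrow> ('o, 'g \<times> 'm) cat" where
  "Ctx_loose C G =
    \<lparr>Ob = Ob C,
     Hom = (\<lambda>X Y. {(P, f). P \<in> Gr G X \<and> f \<in> Hom C (Act G X P) Y}),
     Idt = (\<lambda>X. (IGr G X, Eps G X)),
     Comp = (\<lambda>X Y Z (Q, g) (P, f).
       let XP = Act G X P; YQ = Act G Y Q;
           fQ = Reix G XP Y f Q; XPQ = Act G XP fQ;
           PQ = Ten G X P fQ; X' = Act G X PQ
       in (PQ, Comp C X' YQ Z g
                 (Comp C X' XPQ YQ (ActMap G XP Y f Q) (Del G X P fQ))))\<rparr>"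

text \<open>
  HOL cannot quantify existentially over the type of grades, so it is a parameter.  This loses
  little: by the identity-on-objects equivalence a grade \<open>P\<close> over \<open>X\<close> is determined by the object
  \<open>X \<odot> P\<close> and the Kleisli arrow corresponding to \<open>(P, id) : X \<rightarrow> X \<odot> P\<close>.
\<close>

definition transposable :: "'g itself \<Rightarrow> ('o, 'm) cat \<Rightarrow> ('o, 'm) monad_data \<Rightarrow> bool" where
  "transposable _ C T \<longleftrightarrow> is_monad C T \<and>
     (\<exists>G :: ('o, 'm, 'g) graded_data. dg_comonad C G \<and>
        id_on_obj_equivalent (Kleisli C T) (Ctx_loose C G))"


section \<open>The category of sets\<close>

text \<open>
  A universe is a family \<open>U\<close> of sets over a type \<open>'u\<close> equipped with an encoding of ordered
  pairs, and closed under binary products formed with it.  Nothing else is needed; the sets of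
  a model of ZFC, or of a Grothendieck universe, with Kuratowski pairs are an instance.
\<close>

locale set_universe =
  fixes U :: "'u set set" and pr :: "'u \<times> 'u \<Rightarrow> 'u"
  assumes inj_pr: "inj pr"
    and prod_closed: "\<lbrakk>X \<in> U; Y \<in> U\<rbrakk> \<Longrightarrow> pr ` (X \<times> Y) \<in> U"

definition sets_cat :: "'u set set \<Rightarrow> ('u set, 'u \<Rightarrow> 'u) cat" where
  "sets_cat U =
    \<lparr>Ob = U,
     Hom = (\<lambda>X Y. X \<rightarrow>\<^sub>E Y),
     Idt = (\<lambda>X. \<lambda>x\<in>X. x),
     Comp = (\<lambda>X Y Z g f. compose X g f)\<rparr>"


section \<open>The writer monad and the dependently graded writer comonad\<close>

definition writer_ob :: "('u \<times> 'u \<Rightarrow> 'u) \<Rightarrow> ('u, 'b) monoid_scheme \<Rightarrow> 'u set \<Rightarrow> 'u set" where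
  "writer_ob pr W X = pr ` (X \<times> carrier W)"

definition writer_monad ::
    "('u \<times> 'u \<Rightarrow> 'u) \<Rightarrow> ('u, 'b) monoid_scheme \<Rightarrow> ('u set, 'u \<Rightarrow> 'u) monad_data" where
  "writer_monad pr W =
    \<lparr>Fun = \<lparr>FOb = writer_ob pr W,
            FMap = (\<lambda>X Y f. \<lambda>z\<in>writer_ob pr W X. case inv_into UNIV pr z of (x, w) \<Rightarrow> pr (f x, w))\<rparr>,
     Unit = (\<lambda>X. \<lambda>x\<in>X. pr (x, \<one>\<^bsub>W\<^esub>)),
     Mul = (\<lambda>X. \<lambda>z\<in>writer_ob pr W (writer_ob pr W X).
       case inv_into UNIV pr z of (y, w2) \<Rightarrow> case inv_into UNIV pr y of (x, w1) \<Rightarrow> pr (x, w1 \<otimes>\<^bsub>W\<^esub> w2))\<rparr>"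

definition writer_comonad ::
    "('u, 'b) monoid_scheme \<Rightarrow> ('u set, 'u \<Rightarrow> 'u, 'u \<Rightarrow> 'u) graded_data" where
  "writer_comonad W =
    \<lparr>Gr = (\<lambda>X. X \<rightarrow>\<^sub>E carrier W),
     Reix = (\<lambda>X Y f w. compose X w f),
     Act = (\<lambda>X w. X),
     ActMap = (\<lambda>X Y f w. f),
     IGr = (\<lambda>X. \<lambda>x\<in>X. \<one>\<^bsub>W\<^esub>),
     Ten = (\<lambda>X w1 w2. \<lambda>x\<in>X. w1 x \<otimes>\<^bsub>W\<^esub> w2 x),
     Eps = (\<lambda>X. \<lambda>x\<in>X. x),
     Del = (\<lambda>X w1 w2. \<lambda>x\<in>X. x)\<rparr>"

text \<open>
  With the two orders of multiplication used in \<open>Mul\<close> and in \<open>Ten\<close> above, composing an arrow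
  that writes \<open>u\<close> with one that writes \<open>v\<close> (in this order) produces \<open>v \<otimes> u\<close> in the Kleisli
  category and \<open>u \<otimes> v\<close> in the category of contextful arrows.  The monoids of endomorphisms of
  a one-element set are then the opposite monoid of \<open>W\<close> and \<open>W\<close> itself, so comparing the two
  categories requires passing to the opposite monoid on one of the two sides.
\<close>

definition opposite :: "('u, 'b) monoid_scheme \<Rightarrow> 'u monoid" where
  "opposite W = \<lparr>carrier = carrier W, mult = (\<lambda>x y. y \<otimes>\<^bsub>W\<^esub> x), one = \<one>\<^bsub>W\<^esub>\<rparr>"

end

theory Submission
  imports Defs
begin

text \<open>
  A Kleisli arrow \<open>X \<rightarrow> Y \<times> W\<close> of the writer monad is a pair of functions \<open>f : X \<rightarrow> Y\<close> and
  \<open>P : X \<rightarrow> W\<close>.  The second one is precisely a grade over \<open>X\<close>, and since \<open>X \<odot> P = X\<close>, the pair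
  \<open>(P, f)\<close> is precisely a contextful arrow \<open>X \<rightarrow> Y\<close>.  Splitting a function into a product is thus a
  bijection between hom-sets (\<open>bij_betw_contextful_Kleisli\<close>).  Both compositions send \<open>x\<close> to
  \<open>g (f x)\<close> and combine the outputs \<open>P x\<close> and \<open>Q (f x)\<close> with the monoid operation: the Kleisli
  category in the order \<open>Q (f x) \<otimes> P x\<close>, the contextful arrows in the order \<open>P x \<otimes> Q (f x)\<close>.  Hence
  the bijection is functorial when the grades take values in a monoid \<open>V\<close> and the Kleisli arrows
  write into a monoid \<open>W\<close>, along an isomorphism \<open>\<psi>\<close> from \<open>V\<close> to the opposite of \<open>W\<close>
  (\<open>Kleisli_equivalent_Ctx\<close>).  All three equivalences are instances: \<open>V\<close> is the opposite of \<open>W\<close>,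
  \<open>W\<close> is the opposite of \<open>V\<close>, or \<open>V = W\<close> is isomorphic to its opposite.

  Bijections of hom-sets that respect identities and composition give an isomorphism of
  categories, hence an equivalence, and also carry the category axioms from one side to the
  other (\<open>id_on_obj_equivalentI\<close>).  The axioms are therefore checked only for the contextful
  arrows, where composition has no pairing to undo.  The monad and graded comonad laws hold
  pointwise, by the monoid laws.
\<close>

section \<open>Identity-on-objects equivalences from bijections of hom-sets\<close>

lemma is_functor_id_funct: "category C \<Longrightarrow> is_functor C C id_funct"
  by (simp add: is_functor_def is_functor_axioms_def id_funct_def)

lemma is_functor_comp_funct_self:
  assumes "is_functor C C F"
  shows "is_functor C C (comp_funct F F)"
proof -
  interpret is_functor C C F by fact
  show ?thesis
    by unfold_locales (auto simp: comp_funct_def FOb_closed FMap_closed FMap_Idt FMap_Comp)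
qed

text \<open>
  Every arrow of \<open>D\<close> has the form \<open>K X Y f\<close> and the
  operations of \<open>D\<close> on such arrows are images of those of \<open>C\<close>, so the category axioms pass from \<open>C\<close> to \<open>D\<close>.  The
  inverse bijections then form a functor strictly inverse to \<open>K\<close>, and the natural isomorphisms
  of the equivalence are identities.
\<close>
lemma id_on_obj_equivalentI:
  fixes C :: "('o, 'm) cat" and D :: "('o, 'n) cat" and K :: "'o \<Rightarrow> 'o \<Rightarrow> 'm \<Rightarrow> 'n"
  assumes C: "category C" and Ob: "Ob D = Ob C"
    and bij: "\<And>X Y. \<lbrakk>X \<in> Ob C; Y \<in> Ob C\<rbrakk> \<Longrightarrow> bij_betw (K X Y) (Hom C X Y) (Hom D X Y)"
    and Idt: "\<And>X. X \<in> Ob C \<Longrightarrow> K X X (Idt C X) = Idt D X"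
    and Comp: "\<And>X Y Z f g. \<lbrakk>X \<in> Ob C; Y \<in> Ob C; Z \<in> Ob C; f \<in> Hom C X Y; g \<in> Hom C Y Z\<rbrakk>
      \<Longrightarrow> K X Z (Comp C X Y Z g f) = Comp D X Y Z (K Y Z g) (K X Y f)"
  shows "id_on_obj_equivalent D C"
proof -
  interpret C: category C by (fact C)
  have Hom: "Hom D X Y = K X Y ` Hom C X Y" if "X \<in> Ob C" "Y \<in> Ob C" for X Y
    using bij_betw_imp_surj_on[OF bij] that by blast
  define L where "L X Y = inv_into (Hom C X Y) (K X Y)" for X Y
  have L_K: "L X Y (K X Y f) = f" if "X \<in> Ob C" "Y \<in> Ob C" "f \<in> Hom C X Y" for X Y f
    unfolding L_def using bij_betw_imp_inj_on[OF bij] that by (simp add: inv_into_f_f)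
  note [simp] = Ob Hom L_K C.Idt_closed C.Comp_closed Idt[symmetric] Comp[symmetric]
    C.Idt_left C.Idt_right C.Comp_assoc
  have D: "category D"
    by standard auto
  let ?F = "\<lparr>FOb = \<lambda>X. X, FMap = L\<rparr>" and ?G = "\<lparr>FOb = \<lambda>X. X, FMap = K\<rparr>"
  have F: "is_functor D C ?F"
    using C D by (auto simp: is_functor_def is_functor_axioms_def)
  have G: "is_functor C D ?G"
    using C D by (auto simp: is_functor_def is_functor_axioms_def)
  have id: "naturally_isomorphic E E H id_funct"
    if E: "category E" and H: "\<And>X. FOb H X = X"
      "\<And>X Y f. \<lbrakk>X \<in> Ob E; Y \<in> Ob E; f \<in> Hom E X Y\<rbrakk> \<Longrightarrow> FMap H X Y f = f"
    for E :: "('o, 'k) cat" and H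
  proof -
    interpret E: category E by (fact E)
    show ?thesis
      unfolding naturally_isomorphic_def nat_trans_def nat_trans_axioms_def is_functor_def
        is_functor_axioms_def iso_arrow_def
      using E H by (intro exI[of _ "Idt E"]) (auto simp: id_funct_def E.Idt_closed E.Comp_closed
          E.Idt_left E.Idt_right intro!: bexI[of _ "Idt E _"])
  qed
  have "equivalence D C ?F"
    unfolding equivalence_def
    by (intro conjI F exI[of _ ?G] G id C D) (auto simp: comp_funct_def)
  then show ?thesis
    unfolding id_on_obj_equivalent_def by (auto intro!: exI[of _ ?F])
qed


section \<open>The category of sets and the writer monad\<close>

lemma restrict_eq_iff: "restrict f A = restrict g A \<longleftrightarrow> (\<forall>x \<in> A. f x = g x)"
  by (metis restrict_apply' restrict_ext)

lemma category_sets_cat: "category (sets_cat U)"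
  by standard (auto simp: sets_cat_def compose_def PiE_iff extensional_restrict
          cong: restrict_cong)

context set_universe
begin

lemma inv_pr [simp]: "inv_into UNIV pr (pr p) = p"
  using inj_pr by simp

lemma pr_eq_iff [simp]: "pr p = pr q \<longleftrightarrow> p = q"
  using inj_pr by (simp add: inj_eq)

lemma pr_mem_writer_ob [simp]:
  "pr p \<in> writer_ob pr W X \<longleftrightarrow> fst p \<in> X \<and> snd p \<in> carrier W"
  by (cases p) (auto simp: writer_ob_def)

text \<open>
  With this rule and \<open>restrict_eq_iff\<close>, an equation between functions on \<open>X \<times> W\<close>, or on an iterate
  of this construction, becomes one between their values on encoded pairs, where the decoding
  \<open>inv_into UNIV pr\<close> simplifies away.
\<close>
lemma ball_writer_ob:
  "(\<forall>z \<in> writer_ob pr W X. Q z) \<longleftrightarrow> (\<forall>x \<in> X. \<forall>w \<in> carrier W. Q (pr (x, w)))"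
  by (auto simp: writer_ob_def)

lemma writer_ob_closed: "\<lbrakk>X \<in> U; carrier W \<in> U\<rbrakk> \<Longrightarrow> writer_ob pr W X \<in> U"
  by (simp add: writer_ob_def prod_closed)

lemma is_functor_writer:
  assumes "carrier W \<in> U"
  shows "is_functor (sets_cat U) (sets_cat U) (Fun (writer_monad pr W))"
proof (intro is_functor.intro is_functor_axioms.intro category_sets_cat)
qed (use assms in \<open>auto simp: sets_cat_def writer_monad_def writer_ob_closed compose_def PiE_iff
    extensional_restrict restrict_eq_iff ball_writer_ob cong: restrict_cong\<close>)

lemma is_monad_writer:
  assumes "monoid W" and "carrier W \<in> U"
  shows "is_monad (sets_cat U) (writer_monad pr W)"
proof -
  interpret W: monoid W by fact
  note F = is_functor_writer[OF assms(2)]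
  note [simp] = sets_cat_def writer_monad_def compose_def id_funct_def comp_funct_def
  show ?thesis
  proof (rule is_monad.intro)
    show "nat_trans (sets_cat U) (sets_cat U) id_funct (Fun (writer_monad pr W))
        (Unit (writer_monad pr W))"
      by (intro nat_trans.intro nat_trans_axioms.intro F is_functor_id_funct category_sets_cat)
        (auto simp: PiE_iff extensional_restrict restrict_eq_iff ball_writer_ob
          cong: restrict_cong)
    show "nat_trans (sets_cat U) (sets_cat U)
        (comp_funct (Fun (writer_monad pr W)) (Fun (writer_monad pr W)))
        (Fun (writer_monad pr W)) (Mul (writer_monad pr W))"
      by (intro nat_trans.intro nat_trans_axioms.intro F is_functor_comp_funct_self)
        (auto simp: PiE_iff extensional_restrict restrict_eq_iff ball_writer_ob
          cong: restrict_cong)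
  qed (auto simp: Let_def W.m_assoc PiE_iff extensional_restrict restrict_eq_iff ball_writer_ob
          cong: restrict_cong)
qed

end


section \<open>The writer comonad and its contextful arrows\<close>

lemma dg_comonad_writer:
  assumes "monoid W"
  shows "dg_comonad (sets_cat U) (writer_comonad W)"
proof -
  interpret W: monoid W by fact
  show ?thesis
    by (intro dg_comonad.intro dg_comonad_axioms.intro category_sets_cat)
      (simp_all add: sets_cat_def writer_comonad_def compose_def Let_def PiE_iff extensional_restrict
        W.m_assoc restrict_eq_iff cong: restrict_cong)
qed

text \<open>
  As all structure maps of the writer comonad are identities, a contextful arrow out of \<open>X\<close> is
  a pair of functions on \<open>X\<close>, and its category structure can be computed pointwise.
\<close>
lemma Ctx_writer_simps:
  "Ob (Ctx_loose (sets_cat U) (writer_comonad W)) = U"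
  "Hom (Ctx_loose (sets_cat U) (writer_comonad W)) X Y = (X \<rightarrow>\<^sub>E carrier W) \<times> (X \<rightarrow>\<^sub>E Y)"
  "Idt (Ctx_loose (sets_cat U) (writer_comonad W)) X = (\<lambda>x\<in>X. \<one>\<^bsub>W\<^esub>, \<lambda>x\<in>X. x)"
  "Comp (Ctx_loose (sets_cat U) (writer_comonad W)) X Y Z (Q, g) (P, f) =
    (\<lambda>x\<in>X. P x \<otimes>\<^bsub>W\<^esub> Q (f x), \<lambda>x\<in>X. g (f x))"
  by (auto simp: Ctx_loose_def sets_cat_def writer_comonad_def compose_def Let_def restrict_eq_iff)

lemma category_Ctx_writer:
  assumes "monoid W"
  shows "category (Ctx_loose (sets_cat U) (writer_comonad W))"
proof -
  interpret W: monoid W by fact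
  show ?thesis
    by standard (simp_all add: Ctx_writer_simps split_paired_all PiE_iff extensional_restrict
        W.m_assoc restrict_eq_iff cong: restrict_cong)
qed


section \<open>Comparing Kleisli arrows with contextful arrows\<close>

lemma opposite_simps [simp]:
  "carrier (opposite W) = carrier W"
  "x \<otimes>\<^bsub>opposite W\<^esub> y = y \<otimes>\<^bsub>W\<^esub> x"
  "\<one>\<^bsub>opposite W\<^esub> = \<one>\<^bsub>W\<^esub>"
  by (simp_all add: opposite_def)

lemma monoid_opposite: "monoid W \<Longrightarrow> monoid (opposite W)"
  by (intro monoidI) (simp_all add: monoid.m_closed monoid.m_assoc)

lemma (in set_universe) Kleisli_writer_simps:
  "Ob (Kleisli (sets_cat U) (writer_monad pr W)) = U"
  "Hom (Kleisli (sets_cat U) (writer_monad pr W)) X Y = X \<rightarrow>\<^sub>E writer_ob pr W Y"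
  "Idt (Kleisli (sets_cat U) (writer_monad pr W)) X = (\<lambda>x\<in>X. pr (x, \<one>\<^bsub>W\<^esub>))"
  by (simp_all add: Kleisli_def sets_cat_def writer_monad_def Let_def)

text \<open>
  The output of the later arrow stands on the left: applying the functor to \<open>g\<close> puts its output
  \<open>Q (f x)\<close> in the inner pair, and the multiplication of the monad multiplies the inner output by the
  outer one.
\<close>
lemma (in set_universe) Kleisli_writer_Comp:
  assumes "f \<in> X \<rightarrow> Y" "P \<in> X \<rightarrow> carrier W" "g \<in> Y \<rightarrow> Z" "Q \<in> Y \<rightarrow> carrier W"
  shows "Comp (Kleisli (sets_cat U) (writer_monad pr W)) X Y Z
    (\<lambda>y\<in>Y. pr (g y, Q y)) (\<lambda>x\<in>X. pr (f x, P x)) =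
    (\<lambda>x\<in>X. pr (g (f x), Q (f x) \<otimes>\<^bsub>W\<^esub> P x))"
  using assms
  by (simp add: Kleisli_def sets_cat_def writer_monad_def Let_def compose_def restrict_eq_iff Pi_iff)

text \<open>
  A function into \<open>Y \<times> W\<close> is a pair of functions; the bijection \<open>\<psi>\<close> renames the values of the
  second one, so that grades and outputs may come from different monoids.
\<close>
lemma (in set_universe) bij_betw_contextful_Kleisli:
  assumes \<psi>: "bij_betw \<psi> (carrier V) (carrier W)"
  shows "bij_betw (\<lambda>(P, f). \<lambda>x\<in>X. pr (f x, \<psi> (P x)))
    ((X \<rightarrow>\<^sub>E carrier V) \<times> (X \<rightarrow>\<^sub>E Y)) (X \<rightarrow>\<^sub>E writer_ob pr W Y)"
    (is "bij_betw ?K (?P \<times> ?F) ?B")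
proof (rule bij_betw_imageI)
  have inj: "u = v" if "\<psi> u = \<psi> v" "u \<in> carrier V" "v \<in> carrier V" for u v
    using bij_betw_imp_inj_on[OF \<psi>] that by (rule inj_onD)
  have carrier_W: "carrier W = \<psi> ` carrier V"
    using bij_betw_imp_surj_on[OF \<psi>] by (rule sym)
  show "inj_on ?K (?P \<times> ?F)"
  proof (rule inj_onI)
    fix a b
    assume ab: "a \<in> ?P \<times> ?F" "b \<in> ?P \<times> ?F" and eq: "?K a = ?K b"
    obtain P f P' f' where [simp]: "a = (P, f)" "b = (P', f')"
      by (cases a, cases b)
    have P: "P \<in> ?P" "P' \<in> ?P" and f: "f \<in> ?F" "f' \<in> ?F"
      using ab by simp_all
    have val: "f x = f' x" "\<psi> (P x) = \<psi> (P' x)" if "x \<in> X" for x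
      using eq that by (simp_all add: restrict_eq_iff)
    have "P = P'"
      by (rule PiE_ext[OF P]) (rule inj[OF val(2) PiE_mem[OF P(1)] PiE_mem[OF P(2)]])
    moreover have "f = f'"
      by (rule PiE_ext[OF f]) (rule val(1))
    ultimately show "a = b"
      by simp
  qed
  show "?K ` (?P \<times> ?F) = ?B"
  proof (intro equalityI subsetI)
    fix h assume "h \<in> ?K ` (?P \<times> ?F)"
    then obtain P f where h: "h = ?K (P, f)" and P: "P \<in> ?P" and f: "f \<in> ?F"
      by (elim imageE SigmaE) simp
    show "h \<in> ?B"
      using P f unfolding h by (simp add: carrier_W PiE_iff)
  next
    fix h assume h: "h \<in> ?B"
    have "\<forall>x\<in>X. \<exists>p. h x = pr (snd p, \<psi> (fst p)) \<and> fst p \<in> carrier V \<and> snd p \<in> Y"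
    proof
      fix x assume "x \<in> X"
      then have "h x \<in> pr ` (Y \<times> \<psi> ` carrier V)"
        using PiE_mem[OF h] by (simp add: writer_ob_def carrier_W)
      then show "\<exists>p. h x = pr (snd p, \<psi> (fst p)) \<and> fst p \<in> carrier V \<and> snd p \<in> Y"
        by force
    qed
    then obtain p where p: "\<forall>x\<in>X. h x = pr (snd (p x), \<psi> (fst (p x)))
        \<and> fst (p x) \<in> carrier V \<and> snd (p x) \<in> Y"
      by (rule bchoice[THEN exE])
    let ?q = "(\<lambda>x\<in>X. fst (p x), \<lambda>x\<in>X. snd (p x))"
    have "h = restrict h X"
      using h by simp
    also have "\<dots> = ?K ?q"
      using p by (simp add: restrict_eq_iff)
    finally have "h = ?K ?q" .
    moreover have "?q \<in> ?P \<times> ?F"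
      using p by simp
    ultimately show "h \<in> ?K ` (?P \<times> ?F)"
      by (rule image_eqI)
  qed
qed

text \<open>
  The two categories multiply outputs in opposite orders, which is exactly what an isomorphism
  onto the opposite monoid compensates.
\<close>
lemma (in set_universe) Kleisli_equivalent_Ctx:
  assumes V: "monoid V" and W: "monoid W" and \<psi>: "\<psi> \<in> iso V (opposite W)"
  shows "id_on_obj_equivalent (Kleisli (sets_cat U) (writer_monad pr W))
    (Ctx_loose (sets_cat U) (writer_comonad V))"
proof -
  interpret V: monoid V by fact
  interpret W: monoid W by fact
  have bij: "bij_betw \<psi> (carrier V) (carrier W)"
    and mult: "\<And>u v. \<lbrakk>u \<in> carrier V; v \<in> carrier V\<rbrakk> \<Longrightarrow> \<psi> (u \<otimes>\<^bsub>V\<^esub> v) = \<psi> v \<otimes>\<^bsub>W\<^esub> \<psi> u"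
    using \<psi> by (auto simp: iso_def hom_def)
  have closed: "\<psi> u \<in> carrier W" if "u \<in> carrier V" for u
    using bij_betwE[OF bij] that by blast
  \<comment> \<open>\<open>\<psi>\<close> is only known to reverse products, but \<open>\<psi> \<one>\<close> is a right unit for every element of its image,
    in particular for \<open>\<one>\<close>, which is in the image by surjectivity.\<close>
  have one: "\<psi> \<one>\<^bsub>V\<^esub> = \<one>\<^bsub>W\<^esub>"
  proof -
    have "\<one>\<^bsub>W\<^esub> \<in> \<psi> ` carrier V"
      using bij_betw_imp_surj_on[OF bij] by simp
    then obtain e where e: "e \<in> carrier V" "\<psi> e = \<one>\<^bsub>W\<^esub>"
      by auto
    show ?thesis
      using mult[of "\<one>\<^bsub>V\<^esub>" e] e closed[of "\<one>\<^bsub>V\<^esub>"] by simp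
  qed
  let ?Ctx = "Ctx_loose (sets_cat U) (writer_comonad V)"
    and ?Kl = "Kleisli (sets_cat U) (writer_monad pr W)"
  let ?K = "\<lambda>X (P, f). \<lambda>x\<in>X. pr (f x, \<psi> (P x))"
  show ?thesis
  proof (rule id_on_obj_equivalentI[where K = "\<lambda>X Y. ?K X"])
    show "category ?Ctx"
      by (rule category_Ctx_writer[OF V])
    show "Ob ?Kl = Ob ?Ctx"
      by (simp add: Ctx_writer_simps Kleisli_writer_simps)
    show "bij_betw (?K X) (Hom ?Ctx X Y) (Hom ?Kl X Y)" for X Y
      unfolding Ctx_writer_simps Kleisli_writer_simps by (rule bij_betw_contextful_Kleisli[OF bij])
    show "?K X (Idt ?Ctx X) = Idt ?Kl X" for X
      by (simp add: Ctx_writer_simps Kleisli_writer_simps one restrict_eq_iff)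
    show "?K X (Comp ?Ctx X Y Z g f) = Comp ?Kl X Y Z (?K Y g) (?K X f)"
      if "f \<in> Hom ?Ctx X Y" "g \<in> Hom ?Ctx Y Z" for X Y Z f g
    proof -
      obtain P f' where f: "f = (P, f')" "P \<in> X \<rightarrow>\<^sub>E carrier V" "f' \<in> X \<rightarrow>\<^sub>E Y"
        using \<open>f \<in> Hom ?Ctx X Y\<close> unfolding Ctx_writer_simps by (rule SigmaE)
      obtain Q g' where g: "g = (Q, g')" "Q \<in> Y \<rightarrow>\<^sub>E carrier V" "g' \<in> Y \<rightarrow>\<^sub>E Z"
        using \<open>g \<in> Hom ?Ctx Y Z\<close> unfolding Ctx_writer_simps by (rule SigmaE)
      have "Comp ?Kl X Y Z (?K Y g) (?K X f)
          = (\<lambda>x\<in>X. pr (g' (f' x), \<psi> (Q (f' x)) \<otimes>\<^bsub>W\<^esub> \<psi> (P x)))"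
        using f g by (simp add: Kleisli_writer_Comp[where Z = Z] PiE_iff Pi_iff closed)
      also have "\<dots> = (\<lambda>x\<in>X. pr (g' (f' x), \<psi> (P x \<otimes>\<^bsub>V\<^esub> Q (f' x))))"
        using f g by (simp add: restrict_eq_iff PiE_iff mult)
      also have "\<dots> = ?K X (Comp ?Ctx X Y Z g f)"
        by (simp add: f g Ctx_writer_simps restrict_eq_iff)
      finally show ?thesis by (rule sym)
    qed
  qed
qed

theorem theorem3p35:
  fixes U :: "'u set set" and pr :: "'u \<times> 'u \<Rightarrow> 'u" and W :: "('u, 'b) monoid_scheme"
  assumes "set_universe U pr"
    and "monoid W" and "carrier W \<in> U"
  shows "transposable TYPE('u \<Rightarrow> 'u) (sets_cat U) (writer_monad pr W)
    \<and> dg_comonad (sets_cat U) (writer_comonad W)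
    \<and> id_on_obj_equivalent
        (Kleisli (sets_cat U) (writer_monad pr W))
        (Ctx_loose (sets_cat U) (writer_comonad (opposite W)))
    \<and> id_on_obj_equivalent
        (Kleisli (sets_cat U) (writer_monad pr (opposite W)))
        (Ctx_loose (sets_cat U) (writer_comonad W))
    \<and> (W \<cong> opposite W \<longrightarrow>
        id_on_obj_equivalent
          (Kleisli (sets_cat U) (writer_monad pr W))
          (Ctx_loose (sets_cat U) (writer_comonad W)))"
proof -
  interpret set_universe U pr by fact
  note W = \<open>monoid W\<close> and op = monoid_opposite[OF \<open>monoid W\<close>]
  have "id_on_obj_equivalent (Kleisli (sets_cat U) (writer_monad pr W))
      (Ctx_loose (sets_cat U) (writer_comonad (opposite W)))"
    by (rule Kleisli_equivalent_Ctx[OF op W, of "\<lambda>x. x"]) (simp add: iso_def hom_def bij_betw_def)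
  moreover have "id_on_obj_equivalent (Kleisli (sets_cat U) (writer_monad pr (opposite W)))
      (Ctx_loose (sets_cat U) (writer_comonad W))"
    by (rule Kleisli_equivalent_Ctx[OF W op, of "\<lambda>x. x"]) (simp add: iso_def hom_def bij_betw_def)
  moreover have "id_on_obj_equivalent (Kleisli (sets_cat U) (writer_monad pr W))
      (Ctx_loose (sets_cat U) (writer_comonad W))" if "W \<cong> opposite W"
    using that Kleisli_equivalent_Ctx[OF W W] unfolding is_iso_def by blast
  ultimately show ?thesis
    unfolding transposable_def
    using is_monad_writer[OF W \<open>carrier W \<in> U\<close>] dg_comonad_writer[OF W] dg_comonad_writer[OF op]
    by blast
qed

end
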